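(* Let $\Gamma$ be the random graph with vertex set $\mathbb{N}$, and let $\mathcal{C}_\Gamma$ be the conjugacy equivalence relation on $\operatorname{Aut}\Gamma$, i.e. $f\,\mathcal{C}_\Gamma\, g$ iff there is $h\in\operatorname{Aut}\Gamma$ with $hf=gh$. Let $\mathcal{G}$ be the standard Borel space of graphs with vertex set $\mathbb{N}$ and let $\cong$ be the isomorphism relation on $\mathcal{G}$. Then $\cong$ is Borel reducible to $\mathcal{C}_\Gamma$; that is, there is a Borel map $x\mapsto\phi_x$ from $\mathcal{G}$ to $\operatorname{Aut}\Gamma$ such that for all $x,y\in\mathcal{G}$, $x\cong y$ if and only if $\phi_x$ and $\phi_y$ are conjugate in $\operatorname{Aut}\Gamma$.
   Context: The random graph is the unique (up to isomorphism) countably infinite graph such that for any two finite disjoint sets of vertices $U,V$ there is a vertex adjacent to every member of $U$ and to no member of $V$. The set $\mathcal{G}$ of graphs on $\mathbb{N}$ is identified with the set of edge relations, a Borel subset of $2^{\mathbb{N}\times\mathbb{N}}$, hence a standard Borel space. $\operatorname{Aut}\Gamma$ carries the Polish topology of pointwise convergence (as a closed subgroup of the group of permutations of $\mathbb{N}$, viewed inside $\mathbb{N}^{\mathbb{N}}$) and the associated Borel structure. For equivalence relations $E,F$ on standard Borel spaces $X,Y$, $E$ is Borel reducible to $F$ iff there is a Borel map $f:X\to Y$ with $x\,E\,x' \iff f(x)\,F\,f(x')$ for all $x,x'\in X$. *)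

theory Defs
  imports "HOL-Analysis.Analysis"
begin

text \<open>An element of \<open>nat \<times> nat \<Rightarrow> bool\<close> is an edge relation on the vertex set \<open>nat\<close>, seen as a point of
  the product space \<open>2\<^bsup>nat \<times> nat\<^esup>\<close>: the type carries the product of the discrete topologies on
  \<^typ>\<open>bool\<close>. Likewise \<^typ>\<open>nat \<Rightarrow> nat\<close> carries the topology of pointwise convergence.\<close>

type_synonym edges = "nat \<times> nat \<Rightarrow> bool"

definition is_graph :: "edges \<Rightarrow> bool" where
  "is_graph x \<longleftrightarrow> (\<forall>a. \<not> x (a, a)) \<and> (\<forall>a b. x (a, b) \<longrightarrow> x (b, a))"

definition is_random_graph :: "edges \<Rightarrow> bool" where
  "is_random_graph \<Gamma> \<longleftrightarrow> is_graph \<Gamma> \<and>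
    (\<forall>U V. finite U \<and> finite V \<and> U \<inter> V = {} \<longrightarrow>
      (\<exists>z. (\<forall>u\<in>U. \<Gamma> (z, u)) \<and> (\<forall>v\<in>V. \<not> \<Gamma> (z, v))))"

definition isos :: "edges \<Rightarrow> edges \<Rightarrow> (nat \<Rightarrow> nat) set" where
  "isos x y = {p. bij p \<and> (\<forall>a b. x (a, b) \<longleftrightarrow> y (p a, p b))}"

definition aut :: "edges \<Rightarrow> (nat \<Rightarrow> nat) set" where
  "aut \<Gamma> = isos \<Gamma> \<Gamma>"

definition graph_space :: "edges measure" where
  "graph_space = restrict_space borel {x. is_graph x}"

definition graph_iso_rel :: "edges rel" where
  "graph_iso_rel = {(x, y). is_graph x \<and> is_graph y \<and> isos x y \<noteq> {}}"

definition aut_space :: "edges \<Rightarrow> (nat \<Rightarrow> nat) measure" where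
  "aut_space \<Gamma> = restrict_space borel (aut \<Gamma>)"

definition conjugacy_rel :: "edges \<Rightarrow> (nat \<Rightarrow> nat) rel" where
  "conjugacy_rel \<Gamma> = {(f, g). f \<in> aut \<Gamma> \<and> g \<in> aut \<Gamma> \<and> (\<exists>h\<in>aut \<Gamma>. h \<circ> f = g \<circ> h)}"

text \<open>Of a measure, only the underlying set and the \<open>\<sigma>\<close>-algebra play a role below;
  \<open>X\<close> and \<open>Y\<close> are meant to be standard Borel spaces.\<close>

definition borel_reducible :: "'a measure \<Rightarrow> 'a rel \<Rightarrow> 'b measure \<Rightarrow> 'b rel \<Rightarrow> bool" where
  "borel_reducible X E Y F \<longleftrightarrow>
    (\<exists>\<phi>\<in>measurable X Y. \<forall>x\<in>space X. \<forall>x'\<in>space X. (x, x') \<in> E \<longleftrightarrow> (\<phi> x, \<phi> x') \<in> F)"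

lemma isos_id: "id \<in> isos x x"
  by (simp add: isos_def)

lemma isos_comp: "p \<in> isos x y \<Longrightarrow> q \<in> isos y z \<Longrightarrow> q \<circ> p \<in> isos x z"
  by (auto simp: isos_def bij_comp)

lemma isos_inv: "p \<in> isos x y \<Longrightarrow> inv p \<in> isos y x"
  by (auto simp: isos_def bij_imp_bij_inv bij_is_surj surj_f_inv_f)

lemma space_graph_space: "space graph_space = {x. is_graph x}"
  by (simp add: graph_space_def space_restrict_space)

lemma space_aut_space: "space (aut_space \<Gamma>) = aut \<Gamma>"
  by (simp add: aut_space_def space_restrict_space)

lemma equiv_graph_iso_rel: "equiv (space graph_space) graph_iso_rel"
  unfolding space_graph_space
proof (rule equivI)
  show "graph_iso_rel \<subseteq> {x. is_graph x} \<times> {x. is_graph x}"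
    by (auto simp: graph_iso_rel_def)
  show "refl_on {x. is_graph x} graph_iso_rel"
    using isos_id by (auto simp: refl_on_def graph_iso_rel_def)
  show "sym graph_iso_rel"
    using isos_inv by (fastforce simp: sym_def graph_iso_rel_def)
  show "trans graph_iso_rel"
    using isos_comp by (fastforce simp: trans_def graph_iso_rel_def)
qed

lemma equiv_conjugacy_rel: "equiv (space (aut_space \<Gamma>)) (conjugacy_rel \<Gamma>)"
  unfolding space_aut_space
proof (rule equivI)
  show "conjugacy_rel \<Gamma> \<subseteq> aut \<Gamma> \<times> aut \<Gamma>"
    by (auto simp: conjugacy_rel_def)
  show "refl_on (aut \<Gamma>) (conjugacy_rel \<Gamma>)"
    using isos_id by (fastforce simp: refl_on_def conjugacy_rel_def aut_def)
  show "sym (conjugacy_rel \<Gamma>)"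
  proof (rule symI)
    fix f g assume fg: "(f, g) \<in> conjugacy_rel \<Gamma>"
    then obtain h where h: "h \<in> aut \<Gamma>" "h \<circ> f = g \<circ> h"
      by (auto simp: conjugacy_rel_def)
    then have b: "bij h" by (simp add: aut_def isos_def)
    have "inv h \<circ> g = inv h \<circ> g \<circ> (h \<circ> inv h)"
      using b by (simp add: bij_is_surj surj_iff[THEN iffD1])
    also have "\<dots> = inv h \<circ> (h \<circ> f) \<circ> inv h"
      using h(2) by (simp add: comp_assoc)
    also have "\<dots> = f \<circ> inv h"
      using b by (simp add: bij_is_inj comp_assoc[symmetric])
    finally show "(g, f) \<in> conjugacy_rel \<Gamma>"
      using fg h(1) isos_inv by (auto simp: conjugacy_rel_def aut_def)
  qed
  show "trans (conjugacy_rel \<Gamma>)"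
  proof (rule transI)
    fix f g k assume fg: "(f, g) \<in> conjugacy_rel \<Gamma>" and gk: "(g, k) \<in> conjugacy_rel \<Gamma>"
    then obtain h h' where h: "h \<in> aut \<Gamma>" "h \<circ> f = g \<circ> h" "h' \<in> aut \<Gamma>" "h' \<circ> g = k \<circ> h'"
      by (auto simp: conjugacy_rel_def)
    have "(h' \<circ> h) \<circ> f = k \<circ> (h' \<circ> h)"
      using h by (metis comp_assoc)
    then show "(f, k) \<in> conjugacy_rel \<Gamma>"
      using fg gk h isos_comp by (fastforce simp: conjugacy_rel_def aut_def)
  qed
qed

lemma borel_graphs: "{x. is_graph x} \<in> sets borel"
proof -
  have [measurable]: "(\<lambda>x::edges. x k) \<in> borel_measurable borel" for k
    by (intro borel_measurable_continuous_onI continuous_on_product_coordinates)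
  have [measurable]: "Measurable.pred borel (\<lambda>x::edges. x k)" for k
    using measurable_compose[OF _ pred_intros_logic(1)] measurable_sets[of "\<lambda>x::edges. x k" borel borel "{True}"]
    by (simp add: pred_def vimage_def)
  show ?thesis unfolding is_graph_def by measurable
qed

lemma borel_aut: "aut \<Gamma> \<in> sets borel"
proof -
  have m [measurable]: "(\<lambda>p::nat \<Rightarrow> nat. p a) \<in> measurable borel (count_space UNIV)" for a
    using borel_measurable_continuous_onI[OF continuous_on_product_coordinates[of a]]
    by (metis measurable_cong_sets sets_borel_eq_count_space)
  have "aut \<Gamma> = {p. (\<forall>a b. p a = p b \<longrightarrow> a = b) \<and> (\<forall>b. \<exists>a. p a = b) \<and>
      (\<forall>a b. \<Gamma> (a, b) \<longleftrightarrow> \<Gamma> (p a, p b))}"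
    by (auto simp: aut_def isos_def bij_def inj_def surj_def) metis+
  then show ?thesis by simp measurable
qed

end

theory Submission
  imports Defs
begin

text \<open>Over a graph \<open>x\<close> one freely builds a random graph by adjoining, for every finite set of
  vertices already present, \<open>\<int>\<close>-many new vertices joined to exactly that set. Translating these
  copies hereditarily is an automorphism whose set of fixed vertices spans \<open>x\<close> itself. Since the
  construction is functorial, the random graph together with this automorphism determines \<open>x\<close> up to
  isomorphism, and is determined by it. The back-and-forth construction with least choices yields an
  isomorphism onto \<open>\<Gamma>\<close> depending on \<open>x\<close> in a Borel way, along which the automorphism is
  transported to \<open>\<Gamma>\<close>.\<close>

section \<open>The back-and-forth construction\<close>

text \<open>The witness must avoid \<open>U\<close> and \<open>V\<close>, so that a partial
  isomorphism can be extended by a fresh vertex.\<close>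

definition rado :: "('a \<Rightarrow> 'a \<Rightarrow> bool) \<Rightarrow> bool" where
  "rado R \<longleftrightarrow> symp R \<and> irreflp R \<and>
    (\<forall>U V. finite U \<longrightarrow> finite V \<longrightarrow> U \<inter> V = {} \<longrightarrow>
      (\<exists>z. z \<notin> U \<union> V \<and> (\<forall>u\<in>U. R z u) \<and> (\<forall>v\<in>V. \<not> R z v)))"

lemma rado_extend:
  assumes "rado R" "finite U" "finite V" "U \<inter> V = {}"
  obtains z where "z \<notin> U \<union> V" "\<And>u. u \<in> U \<Longrightarrow> R z u" "\<And>v. v \<in> V \<Longrightarrow> \<not> R z v"
proof -
  have "\<exists>z. z \<notin> U \<union> V \<and> (\<forall>u\<in>U. R z u) \<and> (\<forall>v\<in>V. \<not> R z v)"
    using assms by (simp add: rado_def)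
  then show thesis
    using that by blast
qed

lemma rado_curry:
  assumes "is_random_graph \<Gamma>"
  shows "rado (curry \<Gamma>)"
proof -
  have graph: "\<not> \<Gamma> (a, a)" "\<Gamma> (a, b) \<Longrightarrow> \<Gamma> (b, a)" for a b
    using assms by (auto simp: is_random_graph_def is_graph_def)
  have ext: "\<exists>z. (\<forall>u\<in>U. \<Gamma> (z, u)) \<and> (\<forall>v\<in>V. \<not> \<Gamma> (z, v))"
    if "finite U" "finite V" "U \<inter> V = {}" for U V
    using assms that by (auto simp: is_random_graph_def)
  have "\<exists>z. z \<notin> U \<union> V \<and> (\<forall>u\<in>U. \<Gamma> (z, u)) \<and> (\<forall>v\<in>V. \<not> \<Gamma> (z, v))"
    if UV: "finite U" "finite V" "U \<inter> V = {}" for U V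
  proof -
    \<comment> \<open>A non-neighbour of a common neighbour \<open>w\<close> of \<open>U \<union> V\<close> cannot lie in \<open>U \<union> V\<close>.\<close>
    obtain w where w: "\<forall>u\<in>U \<union> V. \<Gamma> (w, u)"
      using ext[of "U \<union> V" "{}"] UV by auto
    then have "U \<inter> insert w V = {}"
      using UV graph(1) by auto
    then obtain z where "\<forall>u\<in>U. \<Gamma> (z, u)" "\<forall>v\<in>insert w V. \<not> \<Gamma> (z, v)"
      using ext[of U "insert w V"] UV by auto
    then show ?thesis
      using w graph(2) by blast
  qed
  moreover have "symp (curry \<Gamma>)" "irreflp (curry \<Gamma>)"
    unfolding symp_def irreflp_def curry_def using graph by blast+
  ultimately show ?thesis
    unfolding rado_def curry_def by blast
qed

text \<open>The condition for adding a pair to \<open>L\<close>. In a partial isomorphism the pairs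
  already in \<open>L\<close> satisfy it too, so the steps below need not ask whether a vertex has
  been treated before.\<close>

definition matches ::
  "('a \<Rightarrow> 'a \<Rightarrow> bool) \<Rightarrow> ('b \<Rightarrow> 'b \<Rightarrow> bool) \<Rightarrow> ('a \<times> 'b) list \<Rightarrow> 'a \<Rightarrow> 'b \<Rightarrow> bool" where
  "matches A B L a b \<longleftrightarrow> (\<forall>(a', b')\<in>set L. (a = a' \<longleftrightarrow> b = b') \<and> (A a a' \<longleftrightarrow> B b b'))"

definition partial_iso ::
  "('a \<Rightarrow> 'a \<Rightarrow> bool) \<Rightarrow> ('b \<Rightarrow> 'b \<Rightarrow> bool) \<Rightarrow> ('a \<times> 'b) list \<Rightarrow> bool" where
  "partial_iso A B L \<longleftrightarrow> (\<forall>(a, b)\<in>set L. matches A B L a b)"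

lemma matchesD:
  assumes "matches A B L a b" "(a', b') \<in> set L"
  shows "a = a' \<longleftrightarrow> b = b'" "A a a' \<longleftrightarrow> B b b'"
  using assms by (auto simp: matches_def)

lemma partial_isoD: "partial_iso A B L \<Longrightarrow> (a, b) \<in> set L \<Longrightarrow> matches A B L a b"
  by (auto simp: partial_iso_def)

text \<open>Reduces back steps to forth steps between the exchanged graphs.\<close>

lemma matches_swap: "matches B A (map prod.swap L) b a \<longleftrightarrow> matches A B L a b"
  unfolding matches_def set_map ball_simps case_prod_beta by (simp add: eq_commute)

lemma partial_iso_swap: "partial_iso B A (map prod.swap L) \<longleftrightarrow> partial_iso A B L"
  by (simp add: partial_iso_def case_prod_beta matches_swap)

text \<open>A vertex already in the domain keeps its partner. For a new one, the extension property
  of \<open>B\<close> is applied to the images of its neighbours and non-neighbours.\<close>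

lemma ex_matches:
  assumes B: "rado B" and L: "partial_iso A B L"
  shows "\<exists>b. matches A B L a b"
proof (cases "\<exists>b. (a, b) \<in> set L")
  case True
  then show ?thesis
    using L by (blast dest: partial_isoD)
next
  case False
  define U where "U = snd ` {p \<in> set L. A a (fst p)}"
  define V where "V = snd ` {p \<in> set L. \<not> A a (fst p)}"
  have inU: "b' \<in> U" if "(a', b') \<in> set L" "A a a'" for a' b'
    using that unfolding U_def by (intro image_eqI[of _ _ "(a', b')"]) auto
  have inV: "b' \<in> V" if "(a', b') \<in> set L" "\<not> A a a'" for a' b'
    using that unfolding V_def by (intro image_eqI[of _ _ "(a', b')"]) auto
  \<comment> \<open>A common element would be the image of both a neighbour and a non-neighbour of
    \<open>a\<close>, although \<open>L\<close> is injective.\<close>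
  have "U \<inter> V = {}"
  proof (rule ccontr)
    assume "U \<inter> V \<noteq> {}"
    then obtain b c d where "(c, b) \<in> set L" "A a c" "(d, b) \<in> set L" "\<not> A a d"
      by (auto simp: U_def V_def)
    then show False
      using matchesD(1)[OF partial_isoD[OF L], of c b d b] by auto
  qed
  moreover have "finite U" "finite V"
    by (auto simp: U_def V_def)
  ultimately obtain z where z: "z \<notin> U \<union> V" "\<And>u. u \<in> U \<Longrightarrow> B z u" "\<And>v. v \<in> V \<Longrightarrow> \<not> B z v"
    using rado_extend[OF B] by metis
  \<comment> \<open>Both equalities fail: \<open>a\<close> is outside the domain of
    \<open>L\<close>, and \<open>z\<close> is outside its range, which is
    \<open>U \<union> V\<close>.\<close>
  have "(a = a' \<longleftrightarrow> z = b') \<and> (A a a' \<longleftrightarrow> B z b')" if "(a', b') \<in> set L" for a' b'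
  proof (cases "A a a'")
    case True
    then show ?thesis
      using inU[OF that] z False that by auto
  next
    case not_adjacent: False
    then show ?thesis
      using inV[OF that] z False that by auto
  qed
  then have "matches A B L a z"
    by (auto simp: matches_def)
  then show ?thesis ..
qed

text \<open>\<open>matches\<close> compares the new vertices with the old ones in one order only;
  symmetry gives the other order, and irreflexivity settles the new pair against itself.\<close>

lemma partial_iso_Cons:
  assumes "rado A" "rado B" "partial_iso A B L" and ab: "matches A B L a b"
  shows "partial_iso A B ((a, b) # L)"
proof -
  have "matches A B ((a, b) # L) a b"
    using assms by (simp add: rado_def irreflp_def matches_def)
  moreover have "matches A B ((a, b) # L) a' b'" if "(a', b') \<in> set L" for a' b'
  proof -
    have "A a' a \<longleftrightarrow> A a a'" "B b' b \<longleftrightarrow> B b b'"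
      using assms(1,2) by (auto simp: rado_def dest: sympD)
    then show ?thesis
      using partial_isoD[OF assms(3) that] matchesD[OF ab that] by (auto simp: matches_def)
  qed
  ultimately show ?thesis
    by (auto simp: partial_iso_def)
qed

text \<open>Taking the least code makes the choice depend measurably on \<open>A\<close>. If
  \<open>n\<close> is not a code, \<open>from_nat n\<close> is still some vertex, and treating it
  again is harmless.\<close>

definition forth_step ::
  "('a::countable \<Rightarrow> 'a \<Rightarrow> bool) \<Rightarrow> ('b::countable \<Rightarrow> 'b \<Rightarrow> bool) \<Rightarrow> nat \<Rightarrow> ('a \<times> 'b) list \<Rightarrow> ('a \<times> 'b) list"
  where "forth_step A B n L =
    (from_nat n, from_nat (LEAST m. matches A B L (from_nat n) (from_nat m))) # L"

definition back_step ::
  "('a::countable \<Rightarrow> 'a \<Rightarrow> bool) \<Rightarrow> ('b::countable \<Rightarrow> 'b \<Rightarrow> bool) \<Rightarrow> nat \<Rightarrow> ('a \<times> 'b) list \<Rightarrow> ('a \<times> 'b) list"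
  where "back_step A B n L =
    (from_nat (LEAST m. matches A B L (from_nat m) (from_nat n)), from_nat n) # L"

primrec approx ::
  "('a::countable \<Rightarrow> 'a \<Rightarrow> bool) \<Rightarrow> ('b::countable \<Rightarrow> 'b \<Rightarrow> bool) \<Rightarrow> nat \<Rightarrow> ('a \<times> 'b) list" where
  "approx A B 0 = []"
| "approx A B (Suc n) = back_step A B n (forth_step A B n (approx A B n))"

text \<open>Kept as a relation: being a countable union over finite stages, it is measurable in
  \<open>A\<close> as soon as the stages are.\<close>

definition limit_rel ::
  "('a::countable \<Rightarrow> 'a \<Rightarrow> bool) \<Rightarrow> ('b::countable \<Rightarrow> 'b \<Rightarrow> bool) \<Rightarrow> 'a \<Rightarrow> 'b \<Rightarrow> bool" where
  "limit_rel A B a b \<longleftrightarrow> (\<exists>n. (a, b) \<in> set (approx A B n))"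

lemma partial_iso_forth_step:
  assumes "rado A" "rado B" "partial_iso A B L"
  shows "partial_iso A B (forth_step A B n L)"
proof -
  obtain b where "matches A B L (from_nat n) b"
    using ex_matches[OF assms(2,3)] by blast
  then have "matches A B L (from_nat n) (from_nat (to_nat b))"
    by simp
  then have "matches A B L (from_nat n) (from_nat (LEAST m. matches A B L (from_nat n) (from_nat m)))"
    by (rule LeastI)
  then show ?thesis
    unfolding forth_step_def by (rule partial_iso_Cons[OF assms])
qed

lemma partial_iso_back_step:
  assumes "rado A" "rado B" "partial_iso A B L"
  shows "partial_iso A B (back_step A B n L)"
proof -
  have "map prod.swap (back_step A B n L) = forth_step B A n (map prod.swap L)"
    by (simp add: back_step_def forth_step_def matches_swap)
  then show ?thesis
    using partial_iso_forth_step[of B A "map prod.swap L" n] assms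
    by (simp add: partial_iso_swap[of B A, symmetric])
qed

lemma partial_iso_approx:
  assumes "rado A" "rado B"
  shows "partial_iso A B (approx A B n)"
proof (induction n)
  case 0
  show ?case by (simp add: partial_iso_def)
next
  case (Suc n)
  then show ?case
    by (simp add: assms partial_iso_forth_step partial_iso_back_step)
qed

lemma approx_mono: "m \<le> n \<Longrightarrow> set (approx A B m) \<subseteq> set (approx A B n)"
  by (rule lift_Suc_mono_le[of "\<lambda>n. set (approx A B n)"]) (auto simp: back_step_def forth_step_def)

text \<open>The stages increase, so any two pairs of the limit lie in a common one and inherit its
  conditions. A vertex with code \<open>n\<close> has been treated on either side by stage
  \<open>Suc n\<close>.\<close>

lemma limit_rel_iso:
  assumes "rado A" "rado B"
  obtains \<theta> where "bij \<theta>" "\<And>a b. B (\<theta> a) (\<theta> b) \<longleftrightarrow> A a b" "\<And>a b. limit_rel A B a b \<longleftrightarrow> b = \<theta> a"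
proof -
  have iso: "(a = a' \<longleftrightarrow> b = b') \<and> (A a a' \<longleftrightarrow> B b b')"
    if rels: "limit_rel A B a b" "limit_rel A B a' b'" for a a' b b'
  proof -
    obtain m n where "(a, b) \<in> set (approx A B m)" "(a', b') \<in> set (approx A B n)"
      using rels by (auto simp: limit_rel_def)
    then have "(a, b) \<in> set (approx A B (max m n))" "(a', b') \<in> set (approx A B (max m n))"
      using approx_mono[of m "max m n" A B] approx_mono[of n "max m n" A B] by auto
    then show ?thesis
      using partial_iso_approx[OF assms, of "max m n"] by (auto simp: partial_iso_def matches_def)
  qed
  have total: "\<exists>b. limit_rel A B a b" for a
  proof -
    have "\<exists>b. (a, b) \<in> set (approx A B (Suc (to_nat a)))"
      by (auto simp: back_step_def forth_step_def)
    then show ?thesis unfolding limit_rel_def by blast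
  qed
  have surj: "\<exists>a. limit_rel A B a b" for b
  proof -
    have "\<exists>a. (a, b) \<in> set (approx A B (Suc (to_nat b)))"
      by (auto simp: back_step_def)
    then show ?thesis unfolding limit_rel_def by blast
  qed
  obtain \<theta> where \<theta>: "\<And>a. limit_rel A B a (\<theta> a)"
    using total by metis
  show thesis
  proof
    show "bij \<theta>"
    proof (rule bijI)
      show "inj \<theta>"
        using iso[OF \<theta> \<theta>] by (auto intro: injI)
      show "surj \<theta>"
        using surj iso[OF \<theta>] by (metis surjI)
    qed
    show "B (\<theta> a) (\<theta> b) \<longleftrightarrow> A a b" for a b
      using iso[OF \<theta> \<theta>] by blast
    show "limit_rel A B a b \<longleftrightarrow> b = \<theta> a" for a b
      using iso[OF \<theta>, of a b a] \<theta> by auto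
  qed
qed

section \<open>Measurable dependence on the first graph\<close>

lemma measurable_matches:
  assumes "\<And>a b. Measurable.pred M (\<lambda>x. A x a b)"
  shows "Measurable.pred M (\<lambda>x. matches (A x) B L a b)"
  unfolding matches_def case_prod_beta using assms by measurable

lemma measurable_approx:
  fixes A :: "'m \<Rightarrow> 'a::countable \<Rightarrow> 'a \<Rightarrow> bool" and B :: "'b::countable \<Rightarrow> 'b \<Rightarrow> bool"
  assumes "\<And>a b. Measurable.pred M (\<lambda>x. A x a b)"
  shows "(\<lambda>x. approx (A x) B n) \<in> measurable M (count_space UNIV)"
proof (induction n)
  case 0
  show ?case by simp
next
  case (Suc n)
  note [measurable] = measurable_matches[OF assms] Suc
  have [measurable]: "(\<lambda>x. forth_step (A x) B n L) \<in> measurable M (count_space UNIV)"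
    "(\<lambda>x. back_step (A x) B n L) \<in> measurable M (count_space UNIV)" for L
    unfolding forth_step_def back_step_def by measurable
  \<comment> \<open>There are only countably many lists, so measurability of the step for each fixed
    \<open>L\<close> suffices.\<close>
  have [measurable]: "(\<lambda>x. forth_step (A x) B n (approx (A x) B n)) \<in> measurable M (count_space UNIV)"
    by (rule measurable_compose_countable[where f = "\<lambda>L x. forth_step (A x) B n L"]) measurable
  show ?case
    unfolding approx.simps
    by (rule measurable_compose_countable[where f = "\<lambda>L x. back_step (A x) B n L"]) measurable
qed

lemma measurable_limit_rel:
  assumes "\<And>a b. Measurable.pred M (\<lambda>x. A x a b)"
  shows "Measurable.pred M (\<lambda>x. limit_rel (A x) B a b)"
proof -
  note [measurable] = measurable_approx[OF assms]
  show ?thesis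
    unfolding limit_rel_def by measurable
qed


section \<open>The random graph over a graph\<close>

text \<open>\<open>Node n us\<close> is the \<open>n\<close>-th copy of a vertex adjacent to the members of \<open>us\<close>; the order and
  multiplicity in \<open>us\<close> only produce further copies.\<close>

datatype 'a vtx = Base 'a | Node int "'a vtx list"

instance vtx :: (countable) countable
  by countable_datatype

fun join :: "('a \<times> 'a \<Rightarrow> bool) \<Rightarrow> 'a vtx \<Rightarrow> 'a vtx \<Rightarrow> bool" where
  "join x (Base a) (Base b) \<longleftrightarrow> x (a, b)"
| "join x (Base a) (Node n vs) \<longleftrightarrow> Base a \<in> set vs"
| "join x (Node m us) (Base b) \<longleftrightarrow> Base b \<in> set us"
| "join x (Node m us) (Node n vs) \<longleftrightarrow> Node m us \<in> set vs \<or> Node n vs \<in> set us"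

primrec nodes :: "'a vtx \<Rightarrow> 'a vtx set" where
  "nodes (Base a) = {}"
| "nodes (Node n us) = set us"

text \<open>For each \<open>v\<close> the second disjunct concerns only finitely many nodes, so most
  copies of a node are adjacent to \<open>v\<close> only if they list it.\<close>

lemma join_Node: "join x (Node n us) v \<longleftrightarrow> v \<in> set us \<or> Node n us \<in> nodes v"
  by (cases v) auto

lemma finite_nodes: "finite (nodes v)"
  by (cases v) auto

lemma Node_notin_self: "Node n us \<notin> set us"
proof
  assume "Node n us \<in> set us"
  then have "size (Node n us) \<le> size_list size us"
    by (rule size_list_estimation') simp
  then show False by simp
qed

text \<open>A node listing exactly \<open>U\<close> is adjacent to all of \<open>U\<close>. Of its
  infinitely many copies, finitely many lie in \<open>U \<union> V\<close> or are listed by a member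
  of \<open>V\<close>; any other copy is a witness.\<close>

lemma rado_join:
  assumes "is_graph x"
  shows "rado (join x)"
proof -
  have sym: "symp (join x)"
  proof (rule sympI)
    fix u v show "join x u v \<Longrightarrow> join x v u"
      by (cases u; cases v) (use assms in \<open>auto simp: is_graph_def\<close>)
  qed
  have irr: "irreflp (join x)"
  proof (rule irreflpI)
    fix u show "\<not> join x u u"
      by (cases u) (use assms in \<open>auto simp: is_graph_def Node_notin_self\<close>)
  qed
  have "\<exists>z. z \<notin> U \<union> V \<and> (\<forall>u\<in>U. join x z u) \<and> (\<forall>v\<in>V. \<not> join x z v)"
    if UV: "finite U" "finite V" "U \<inter> V = {}" for U V
  proof -
    obtain us where us: "set us = U"
      using UV finite_list by blast
    have "finite (U \<union> V \<union> (\<Union>v\<in>V. nodes v))"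
      using UV finite_nodes by auto
    moreover have "infinite (range (\<lambda>n. Node n us))"
      by (simp add: finite_image_iff inj_def infinite_UNIV_char_0 range_inj_infinite)
    ultimately obtain n where "Node n us \<notin> U \<union> V \<union> (\<Union>v\<in>V. nodes v)"
      by (metis finite_subset image_subsetI)
    then show ?thesis
      using us UV by (intro exI[of _ "Node n us"]) (auto simp: join_Node)
  qed
  then show ?thesis
    using sym irr by (simp add: rado_def)
qed

section \<open>The shift automorphism and its fixed vertices\<close>

primrec shift :: "int \<Rightarrow> 'a vtx \<Rightarrow> 'a vtx" where
  "shift k (Base a) = Base a"
| "shift k (Node n us) = Node (n + k) (map (shift k) us)"

lemma shift_shift: "shift k (shift l v) = shift (l + k) v"
  by (induction v) auto

lemma shift_0: "shift 0 v = v"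
  by (induction v) (auto simp: map_idI)

lemma bij_shift: "bij (shift k)"
  by (rule o_bij[of "shift (- k)"]) (auto simp: shift_shift shift_0)

text \<open>Adjacency involving a node is list membership, and the injective \<open>shift k\<close>
  acts on lists entrywise; base vertices do not move.\<close>

lemma join_shift: "join x (shift k u) (shift k v) \<longleftrightarrow> join x u v"
proof -
  have im: "shift k w \<in> shift k ` W \<longleftrightarrow> w \<in> W" for w :: "'a vtx" and W
    by (simp add: bij_shift bij_is_inj inj_image_mem_iff)
  show ?thesis
    using im[of "Base _"] im[of "Node _ _"] by (cases u; cases v) simp_all
qed

text \<open>Every node changes its index, so the automorphism remembers which vertices are the
  original ones.\<close>

lemma shift_fixed_iff: "shift 1 v = v \<longleftrightarrow> v \<in> range Base"
  by (cases v) auto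

section \<open>Functoriality, and recovery of the graph\<close>

lemma shift_map_vtx: "shift k (map_vtx p v) = map_vtx p (shift k v)"
  by (induction v) auto

lemma bij_map_vtx:
  assumes "bij p"
  shows "bij (map_vtx p)"
proof (rule o_bij)
  show "map_vtx (inv p) \<circ> map_vtx p = id"
    using assms by (simp add: vtx.map_comp fun_eq_iff bij_is_inj vtx.map_id)
  show "map_vtx p \<circ> map_vtx (inv p) = id"
    using assms by (simp add: vtx.map_comp fun_eq_iff bij_is_surj surj_iff[THEN iffD1] vtx.map_id)
qed

text \<open>Between base vertices \<open>p\<close> itself preserves adjacency; elsewhere adjacency
  is list membership, preserved because \<open>map_vtx p\<close> is injective.\<close>

lemma join_map_vtx:
  assumes "p \<in> isos x y"
  shows "join y (map_vtx p u) (map_vtx p v) \<longleftrightarrow> join x u v"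
proof -
  have p: "bij p" "\<And>a b. y (p a, p b) \<longleftrightarrow> x (a, b)"
    using assms by (auto simp: isos_def)
  have im: "map_vtx p w \<in> map_vtx p ` W \<longleftrightarrow> w \<in> W" for w W
    by (simp add: bij_map_vtx p(1) bij_is_inj inj_image_mem_iff)
  show ?thesis
    using im[of "Base _"] im[of "Node _ _"] p(2) by (cases u; cases v) simp_all
qed

text \<open>Since \<open>k\<close> commutes with the shift, it respects in both directions being
  fixed, that is, being a base vertex. On base vertices \<open>join\<close> is the given graph, so
  \<open>k\<close> restricts to an isomorphism.\<close>

lemma isos_of_join:
  assumes k: "bij k" "\<And>u v. join y (k u) (k v) \<longleftrightarrow> join x u v" "\<And>v. shift 1 (k v) = k (shift 1 v)"
  shows "isos x y \<noteq> {}"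
proof -
  have base: "k v \<in> range Base \<longleftrightarrow> v \<in> range Base" for v
    unfolding shift_fixed_iff[symmetric] k(3) using k(1) by (simp add: bij_is_inj inj_eq)
  have "\<exists>b. k (Base a) = Base b" for a
    using base[of "Base a"] by auto
  then obtain p where p: "\<And>a. k (Base a) = Base (p a)"
    by metis
  have "inj p"
  proof (rule injI)
    fix a b assume "p a = p b"
    then have "k (Base a) = k (Base b)"
      by (simp add: p)
    then show "a = b"
      using k(1) by (simp add: bij_is_inj inj_eq)
  qed
  moreover have "surj p"
    unfolding surj_def
  proof
    fix b
    obtain v where v: "k v = Base b"
      using surjD[OF bij_is_surj[OF k(1)], of "Base b"] by auto
    then obtain a where "v = Base a"
      using base[of v] by auto
    then show "\<exists>a. b = p a"
      using v p by auto
  qed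
  moreover have "x (a, b) \<longleftrightarrow> y (p a, p b)" for a b
    using k(2)[of "Base a" "Base b"] p by simp
  ultimately show ?thesis
    by (auto simp: isos_def bij_def)
qed

section \<open>The Borel reduction\<close>

lemma measurable_join: "Measurable.pred borel (\<lambda>x::edges. join x u v)"
proof -
  have "(\<lambda>x::edges. x k) \<in> borel_measurable borel" for k
    by (intro borel_measurable_continuous_onI continuous_on_product_coordinates)
  then have "Measurable.pred borel (\<lambda>x::edges. x k)" for k
    by (metis measurable_cong_sets sets_borel_eq_count_space)
  \<comment> \<open>For fixed \<open>u\<close> and \<open>v\<close> the value is one coordinate of
    \<open>x\<close> if both are base vertices, and constant in \<open>x\<close> otherwise.\<close>
  then show ?thesis
    by (cases u; cases v) simp_all
qed

theorem theorem3p2: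
  fixes \<Gamma> :: edges
  assumes "is_random_graph \<Gamma>"
  shows "borel_reducible graph_space graph_iso_rel (aut_space \<Gamma>) (conjugacy_rel \<Gamma>)"
proof -
  \<comment> \<open>The isomorphism \<open>\<theta> x\<close> is obtained below by choice; its graph
    \<open>\<Theta> x\<close> is what carries the measurability in \<open>x\<close>.\<close>
  define \<Theta> where "\<Theta> x = limit_rel (join x) (curry \<Gamma>)" for x :: edges
  have "\<exists>\<theta>. bij \<theta> \<and> (\<forall>u v. \<Gamma> (\<theta> u, \<theta> v) \<longleftrightarrow> join x u v) \<and> (\<forall>u b. \<Theta> x u b \<longleftrightarrow> b = \<theta> u)"
    if x: "is_graph x" for x
  proof -
    obtain \<theta> where "bij \<theta>" "\<And>u v. curry \<Gamma> (\<theta> u) (\<theta> v) \<longleftrightarrow> join x u v"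
      "\<And>u b. limit_rel (join x) (curry \<Gamma>) u b \<longleftrightarrow> b = \<theta> u"
      by (rule limit_rel_iso[OF rado_join[OF x] rado_curry[OF assms]]) (rule that)
    then show ?thesis
      by (intro exI[of _ \<theta>]) (simp add: \<Theta>_def)
  qed
  then obtain \<theta> where \<theta>: "\<And>x. is_graph x \<Longrightarrow> bij (\<theta> x)"
    "\<And>x u v. is_graph x \<Longrightarrow> \<Gamma> (\<theta> x u, \<theta> x v) \<longleftrightarrow> join x u v"
    "\<And>x u b. is_graph x \<Longrightarrow> \<Theta> x u b \<longleftrightarrow> b = \<theta> x u"
    by metis
  have inv_\<theta> [simp]: "inv (\<theta> x) (\<theta> x u) = u" "\<theta> x (inv (\<theta> x) b) = b" if "is_graph x" for x u b
    using \<theta>(1)[OF that] by (simp_all add: bij_is_inj bij_is_surj surj_f_inv_f)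
  define \<phi> where "\<phi> x = \<theta> x \<circ> shift 1 \<circ> inv (\<theta> x)" for x
  have \<phi>_\<theta>: "\<phi> x (\<theta> x u) = \<theta> x (shift 1 u)" if "is_graph x" for x u
    using that by (simp add: \<phi>_def)
  have \<phi>_aut: "\<phi> x \<in> aut \<Gamma>" if x: "is_graph x" for x
  proof -
    \<comment> \<open>Every vertex of \<open>\<Gamma>\<close> is of the form
      \<open>\<theta> x u\<close>, so checking these is enough.\<close>
    have "\<Gamma> (\<phi> x (\<theta> x u), \<phi> x (\<theta> x v)) \<longleftrightarrow> \<Gamma> (\<theta> x u, \<theta> x v)" for u v
      by (simp add: x \<phi>_\<theta> \<theta>(2) join_shift)
    from this[of "inv (\<theta> x) _" "inv (\<theta> x) _"]
    have "\<Gamma> (a, b) \<longleftrightarrow> \<Gamma> (\<phi> x a, \<phi> x b)" for a b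
      by (simp add: x)
    moreover have "bij (\<phi> x)"
      unfolding \<phi>_def by (intro bij_comp bij_shift bij_imp_bij_inv \<theta>(1) x)
    ultimately show ?thesis
      by (simp add: aut_def isos_def)
  qed
  have \<phi>_measurable: "\<phi> \<in> measurable graph_space (aut_space \<Gamma>)"
    unfolding aut_space_def
  proof (rule measurable_restrict_space2)
    show "\<phi> \<in> space graph_space \<rightarrow> aut \<Gamma>"
      by (simp add: space_graph_space \<phi>_aut)
    have [measurable]: "Measurable.pred graph_space (\<lambda>x. \<Theta> x u b)" for u b
      unfolding \<Theta>_def graph_space_def
      by (intro measurable_limit_rel measurable_restrict_space1 measurable_join)
    have "(\<lambda>x. \<phi> x c) \<in> measurable graph_space (count_space UNIV)" for c
    proof -
      \<comment> \<open>Expresses \<open>\<phi> x c\<close> through \<open>\<Theta>\<close> and a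
        countable quantifier, without \<open>inv\<close>; exactly one \<open>d\<close> qualifies, so
        \<open>LEAST\<close> merely names it.\<close>
      have "(\<lambda>x. LEAST d. \<exists>u. \<Theta> x u c \<and> \<Theta> x (shift 1 u) d) \<in> measurable graph_space (count_space UNIV)"
        by measurable
      moreover have "(LEAST d. \<exists>u. \<Theta> x u c \<and> \<Theta> x (shift 1 u) d) = \<phi> x c"
        if "x \<in> space graph_space" for x
      proof -
        have x: "is_graph x"
          using that by (simp add: space_graph_space)
        have "(\<exists>u. \<Theta> x u c \<and> \<Theta> x (shift 1 u) d) \<longleftrightarrow> d = \<phi> x c" for d
          unfolding \<theta>(3)[OF x] using \<phi>_\<theta>[OF x] inv_\<theta>[OF x] by metis
        then show ?thesis
          by (simp add: Least_equality)
      qed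
      ultimately show ?thesis
        by (simp cong: measurable_cong)
    qed
    then have "(\<lambda>x. \<phi> x c) \<in> borel_measurable graph_space" for c
      by (metis measurable_cong_sets sets_borel_eq_count_space)
    then show "\<phi> \<in> borel_measurable graph_space"
      by (rule measurable_coordinatewise_then_product)
  qed
  have "(x, y) \<in> graph_iso_rel \<longleftrightarrow> (\<phi> x, \<phi> y) \<in> conjugacy_rel \<Gamma>"
    if x: "is_graph x" and y: "is_graph y" for x y
  proof
    assume "(x, y) \<in> graph_iso_rel"
    then obtain p where p: "p \<in> isos x y"
      by (auto simp: graph_iso_rel_def)
    \<comment> \<open>The extension of \<open>p\<close> to the graphs built over \<open>x\<close>
      and \<open>y\<close>, carried over to \<open>\<Gamma>\<close>. It intertwines
      \<open>\<phi> x\<close> and \<open>\<phi> y\<close> because \<open>map_vtx p\<close> leaves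
      the indices alone.\<close>
    define h where "h = \<theta> y \<circ> map_vtx p \<circ> inv (\<theta> x)"
    have h_\<theta>: "h (\<theta> x u) = \<theta> y (map_vtx p u)" for u
      by (simp add: h_def x)
    have "\<Gamma> (h (\<theta> x u), h (\<theta> x v)) \<longleftrightarrow> \<Gamma> (\<theta> x u, \<theta> x v)" for u v
      by (simp add: h_\<theta> x y \<theta>(2) join_map_vtx[OF p])
    from this[of "inv (\<theta> x) _" "inv (\<theta> x) _"]
    have "\<Gamma> (a, b) \<longleftrightarrow> \<Gamma> (h a, h b)" for a b
      by (simp add: x)
    moreover have "bij h"
      unfolding h_def using p
      by (intro bij_comp bij_map_vtx bij_imp_bij_inv \<theta>(1) x y) (simp add: isos_def)
    ultimately have "h \<in> aut \<Gamma>"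
      by (simp add: aut_def isos_def)
    moreover have "h (\<phi> x (\<theta> x u)) = \<phi> y (h (\<theta> x u))" for u
      by (simp add: h_\<theta> \<phi>_\<theta> x y shift_map_vtx)
    from this[of "inv (\<theta> x) _"] have "h \<circ> \<phi> x = \<phi> y \<circ> h"
      by (simp add: fun_eq_iff x)
    ultimately show "(\<phi> x, \<phi> y) \<in> conjugacy_rel \<Gamma>"
      using \<phi>_aut x y by (auto simp: conjugacy_rel_def)
  next
    assume "(\<phi> x, \<phi> y) \<in> conjugacy_rel \<Gamma>"
    then obtain h where h: "bij h" "\<And>a b. \<Gamma> (h a, h b) \<longleftrightarrow> \<Gamma> (a, b)" "\<And>a. h (\<phi> x a) = \<phi> y (h a)"
      by (auto simp: conjugacy_rel_def aut_def isos_def fun_eq_iff)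
    \<comment> \<open>The conjugating automorphism pulled back to a map between the graphs built
      over \<open>x\<close> and \<open>y\<close>.\<close>
    define k where "k = inv (\<theta> y) \<circ> h \<circ> \<theta> x"
    have \<theta>_k: "\<theta> y (k u) = h (\<theta> x u)" for u
      by (simp add: k_def y)
    have "isos x y \<noteq> {}"
    proof (rule isos_of_join)
      show "bij k"
        unfolding k_def by (intro bij_comp bij_imp_bij_inv \<theta>(1) h x y)
      show "join y (k u) (k v) \<longleftrightarrow> join x u v" for u v
        using \<theta>(2)[OF y, of "k u" "k v"] by (simp add: \<theta>_k h(2) \<theta>(2) x)
      show "shift 1 (k v) = k (shift 1 v)" for v
      proof -
        \<comment> \<open>Under \<open>\<theta> y\<close> the shift becomes \<open>\<phi> y\<close>,
          so the conjugacy equation for \<open>h\<close> applies; injectivity then removes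
          \<open>\<theta> y\<close>.\<close>
        have "\<theta> y (shift 1 (k v)) = \<theta> y (k (shift 1 v))"
          by (simp add: \<phi>_\<theta>[symmetric] \<theta>_k x y h(3))
        then show ?thesis
          using \<theta>(1)[OF y] by (simp add: bij_is_inj inj_eq)
      qed
    qed
    then show "(x, y) \<in> graph_iso_rel"
      using x y by (simp add: graph_iso_rel_def)
  qed
  then show ?thesis
    unfolding borel_reducible_def space_graph_space using \<phi>_measurable by blast
qed

end
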